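(* Let $T$ be a compact metric space and $d\in\mathbb N$. Then the pair $(C_{\mathbb R^d}(T),M^b_{\mathbb R^d}(T))$ is admissible under the norm $\|f\|_{\sup}:=\sup_{t\in T}|f(t)|_\infty$. In particular, if $r\in(0,\infty)$ and $X=(X_t)_{t\in T}$ is an $\mathbb R^d$-valued pathwise continuous process with $\mathbb E\|X\|_{\sup}^r<\infty$, then for every $n\in\mathbb N$, $$\mathcal C_{n,r}(X,M^b_{\mathbb R^d}(T))\neq\emptyset .$$
   Context: $|\cdot|_\infty$ is the $\ell^\infty$-norm on $\mathbb R^d$. $C_{\mathbb R^d}(T)$ is the space of continuous functions $T\to\mathbb R^d$ and $M^b_{\mathbb R^d}(T)$ the space of bounded Borel measurable functions $T\to\mathbb R^d$ (functions, not equivalence classes); both are Banach spaces under $\|\cdot\|_{\sup}$. A pathwise continuous process $X=(X_t)_{t\in T}$ is viewed as a random variable with values in $C_{\mathbb R^d}(T)$, hence also in $M^b_{\mathbb R^d}(T)$. A pair $(F,G)$ consisting of a Banach space $G$ and a Banach (closed linear) subspace $F$ is admissible if the system $\{B_G(x,\rho):x\in F,\rho>0\}$ of closed balls $B_G(x,\rho)=\{y\in G:\|y-x\|\le\rho\}$ is compact: each of its subsystems all of whose finite subsystems have nonempty intersection has itself nonempty intersection. For a random variable $X$ in a Banach space $(G,\|\cdot\|)$ and $n\in\mathbb N$, $\mathcal C_{n,r}(X,G)$ is the set of all $\alpha\subset G$ with $1\le\mathrm{card}(\alpha)\le n$ such that $$\big(\mathbb E\min_{a\in\alpha}\|X-a\|^r\big)^{1/r}=\inf\Big\{\big(\mathbb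 E\min_{b\in\beta}\|X-b\|^r\big)^{1/r}:\beta\subset G,\ 1\le\mathrm{card}(\beta)\le n\Big\}.$$ *)

theory Defs
  imports "HOL-Probability.Probability"
begin

text \<open>
  Bounded Borel functions on the whole domain type. Their norm takes the supremum over the whole
  domain of \<open>infnorm\<close>, which on \<open>real ^ 'd\<close> is the maximum norm of the coordinates
  (\<open>infnorm_cart\<close>), and not of the Euclidean \<open>norm\<close>.
\<close>

typedef (overloaded) ('a, 'b) bmfun =
  "{f :: 'a::topological_space \<Rightarrow> 'b::euclidean_space. f \<in> borel_measurable borel \<and> bounded (range f)}"
  morphisms apply_bmfun Bmfun
  by (rule exI[of _ "\<lambda>_. 0"]) auto

setup_lifting type_definition_bmfun

lemma bmfun_eqI: "(\<And>t. apply_bmfun f t = apply_bmfun g t) \<Longrightarrow> f = g"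
  by transfer auto

lemma Bmfun_inverse_continuous:
  fixes f :: "'a::topological_space \<Rightarrow> 'b::euclidean_space"
  assumes "compact (UNIV :: 'a set)" "continuous_on UNIV f"
  shows "apply_bmfun (Bmfun f) = f"
  using assms
  by (intro Bmfun_inverse)
     (auto intro: borel_measurable_continuous_onI compact_imp_bounded compact_continuous_image)

instantiation bmfun :: (topological_space, euclidean_space) real_vector
begin

lift_definition zero_bmfun :: "('a, 'b) bmfun" is "\<lambda>_. 0"
  by auto

lift_definition uminus_bmfun :: "('a, 'b) bmfun \<Rightarrow> ('a, 'b) bmfun" is "\<lambda>f t. - f t"
  by auto

lift_definition plus_bmfun :: "('a, 'b) bmfun \<Rightarrow> ('a, 'b) bmfun \<Rightarrow> ('a, 'b) bmfun"
  is "\<lambda>f g t. f t + g t"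
  by (auto intro: bounded_plus_comp)

lift_definition minus_bmfun :: "('a, 'b) bmfun \<Rightarrow> ('a, 'b) bmfun \<Rightarrow> ('a, 'b) bmfun"
  is "\<lambda>f g t. f t - g t"
  by (auto intro: bounded_minus_comp)

lift_definition scaleR_bmfun :: "real \<Rightarrow> ('a, 'b) bmfun \<Rightarrow> ('a, 'b) bmfun"
  is "\<lambda>c f t. c *\<^sub>R f t"
  by (auto intro: bounded_scaleR_comp)

instance
  by standard (transfer; simp add: fun_eq_iff algebra_simps)+

end

instantiation bmfun :: (topological_space, euclidean_space) real_normed_vector
begin

definition norm_bmfun :: "('a, 'b) bmfun \<Rightarrow> real"
  where "norm_bmfun f = (SUP t. infnorm (apply_bmfun f t))"

definition dist_bmfun :: "('a, 'b) bmfun \<Rightarrow> ('a, 'b) bmfun \<Rightarrow> real"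
  where "dist_bmfun f g = norm (f - g)"

definition sgn_bmfun :: "('a, 'b) bmfun \<Rightarrow> ('a, 'b) bmfun"
  where "sgn_bmfun f = f /\<^sub>R norm f"

definition uniformity_bmfun :: "(('a, 'b) bmfun \<times> ('a, 'b) bmfun) filter"
  where "uniformity_bmfun = (INF e\<in>{0<..}. principal {(f, g). dist f g < e})"

definition open_bmfun :: "('a, 'b) bmfun set \<Rightarrow> bool"
  where "open_bmfun S \<longleftrightarrow> (\<forall>f\<in>S. \<forall>\<^sub>F (f', g) in uniformity. f' = f \<longrightarrow> g \<in> S)"

lemma bdd_above_infnorm_bmfun: "bdd_above (range (\<lambda>t. infnorm (apply_bmfun f t)))"
proof -
  have "bounded (range (apply_bmfun f))"
    using apply_bmfun[of f] by simp
  then obtain B where "\<And>t. norm (apply_bmfun f t) \<le> B"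
    by (auto simp: bounded_iff)
  then show ?thesis
    by (intro bdd_aboveI2[where M = B]) (meson infnorm_le_norm order_trans)
qed

lemma infnorm_le_norm_bmfun: "infnorm (apply_bmfun f t) \<le> norm f"
  unfolding norm_bmfun_def by (rule cSUP_upper[OF UNIV_I bdd_above_infnorm_bmfun])

lemma norm_bmfun_leI: "(\<And>t. infnorm (apply_bmfun f t) \<le> c) \<Longrightarrow> norm f \<le> c"
  unfolding norm_bmfun_def by (rule cSUP_least) auto

instance
proof
  fix f g :: "('a, 'b) bmfun" and c :: real
  show "dist f g = norm (f - g)" by (rule dist_bmfun_def)
  show "sgn f = f /\<^sub>R norm f" by (rule sgn_bmfun_def)
  show "uniformity = (INF e\<in>{0<..}. principal {(f :: ('a, 'b) bmfun, g). dist f g < e})"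
    by (rule uniformity_bmfun_def)
  show "open S \<longleftrightarrow> (\<forall>f\<in>S. \<forall>\<^sub>F (f', g) in uniformity. f' = f \<longrightarrow> g \<in> S)"
    for S :: "('a, 'b) bmfun set" by (rule open_bmfun_def)
  show "norm f = 0 \<longleftrightarrow> f = 0"
  proof
    assume "norm f = 0"
    then have "infnorm (apply_bmfun f t) = 0" for t
      using infnorm_le_norm_bmfun[of f t] infnorm_pos_le[of "apply_bmfun f t"] by simp
    then show "f = 0"
      by (intro bmfun_eqI) (simp add: infnorm_eq_0 zero_bmfun.rep_eq)
  qed (simp add: norm_bmfun_def zero_bmfun.rep_eq infnorm_0)
  show "norm (f + g) \<le> norm f + norm g"
  proof (rule norm_bmfun_leI)
    fix t
    show "infnorm (apply_bmfun (f + g) t) \<le> norm f + norm g"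
      using infnorm_triangle[of "apply_bmfun f t" "apply_bmfun g t"]
        infnorm_le_norm_bmfun[of f t] infnorm_le_norm_bmfun[of g t]
      by (simp add: plus_bmfun.rep_eq)
  qed
  have scale: "norm (c *\<^sub>R f) \<le> \<bar>c\<bar> * norm f" for c and f :: "('a, 'b) bmfun"
    by (rule norm_bmfun_leI)
       (simp add: scaleR_bmfun.rep_eq infnorm_mul mult_left_mono infnorm_le_norm_bmfun)
  show "norm (c *\<^sub>R f) = \<bar>c\<bar> * norm f"
  proof (cases "c = 0")
    case True
    then show ?thesis by (simp add: norm_bmfun_def zero_bmfun.rep_eq infnorm_0)
  next
    case False
    have "norm f \<le> \<bar>inverse c\<bar> * norm (c *\<^sub>R f)"
      using scale[of "inverse c" "c *\<^sub>R f"] False by simp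
    then have "\<bar>c\<bar> * norm f \<le> norm (c *\<^sub>R f)"
      using False by (simp add: field_simps)
    then show ?thesis using scale[of c f] by simp
  qed
qed

end

instance bmfun :: (topological_space, euclidean_space) banach
proof
  fix F :: "nat \<Rightarrow> ('a, 'b) bmfun"
  assume "Cauchy F"
  have diff: "infnorm (apply_bmfun f t - apply_bmfun g t) \<le> dist f g"
    for f g :: "('a, 'b) bmfun" and t
    using infnorm_le_norm_bmfun[of "f - g" t] by (simp add: minus_bmfun.rep_eq dist_norm)
  have "Cauchy (\<lambda>n. apply_bmfun (F n) t)" for t
  proof (rule metric_CauchyI)
    fix e :: real assume "e > 0"
    define K where "K = sqrt (real DIM('b))"
    have K: "K > 0" by (simp add: K_def)
    from \<open>Cauchy F\<close> \<open>e > 0\<close> K obtain N where N: "\<And>m n. m \<ge> N \<Longrightarrow> n \<ge> N \<Longrightarrow> dist (F m) (F n) < e / K"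
      unfolding Cauchy_def by (meson divide_pos_pos)
    have "dist (apply_bmfun (F m) t) (apply_bmfun (F n) t) < e" if "m \<ge> N" "n \<ge> N" for m n
    proof -
      have "dist (apply_bmfun (F m) t) (apply_bmfun (F n) t) \<le> K * infnorm (apply_bmfun (F m) t - apply_bmfun (F n) t)"
        unfolding dist_norm K_def by (rule norm_le_infnorm)
      also have "\<dots> \<le> K * dist (F m) (F n)" using K diff by (simp add: mult_left_mono)
      also have "\<dots> < e" using N[OF that] K by (simp add: field_simps)
      finally show ?thesis .
    qed
    then show "\<exists>N. \<forall>m\<ge>N. \<forall>n\<ge>N. dist (apply_bmfun (F m) t) (apply_bmfun (F n) t) < e" by blast
  qed
  then have "\<exists>l. (\<lambda>n. apply_bmfun (F n) t) \<longlonglongrightarrow> l" for t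
    by (simp add: Cauchy_convergent_iff convergent_def)
  then obtain g where g: "\<And>t. (\<lambda>n. apply_bmfun (F n) t) \<longlonglongrightarrow> g t" by metis
  have lim: "\<exists>N. \<forall>n\<ge>N. \<forall>t. infnorm (apply_bmfun (F n) t - g t) \<le> e" if "e > 0" for e
  proof -
    from \<open>Cauchy F\<close> that obtain N where N: "\<And>m n. m \<ge> N \<Longrightarrow> n \<ge> N \<Longrightarrow> dist (F m) (F n) < e"
      unfolding Cauchy_def by meson
    have "infnorm (apply_bmfun (F n) t - g t) \<le> e" if "n \<ge> N" for n t
    proof (rule LIMSEQ_le_const2)
      show "(\<lambda>m. infnorm (apply_bmfun (F n) t - apply_bmfun (F m) t)) \<longlonglongrightarrow> infnorm (apply_bmfun (F n) t - g t)"
        by (intro tendsto_intros g)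
      show "\<exists>N. \<forall>m\<ge>N. infnorm (apply_bmfun (F n) t - apply_bmfun (F m) t) \<le> e"
        using N that diff by (meson less_imp_le order_trans)
    qed
    then show ?thesis by blast
  qed
  have meas: "g \<in> borel_measurable borel"
    by (rule borel_measurable_LIMSEQ_metric[of "\<lambda>n. apply_bmfun (F n)"])
       (use apply_bmfun in \<open>auto intro: g\<close>)
  have "bounded (range g)"
  proof -
    obtain N where N: "\<And>t. infnorm (apply_bmfun (F N) t - g t) \<le> 1" using lim[of 1] by auto
    have "norm (g t) \<le> sqrt (real DIM('b)) * (norm (F N) + 1)" for t
    proof -
      have "infnorm (g t) \<le> infnorm (apply_bmfun (F N) t) + infnorm (g t - apply_bmfun (F N) t)"
        using infnorm_triangle[of "apply_bmfun (F N) t" "g t - apply_bmfun (F N) t"] by simp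
      also have "\<dots> \<le> norm (F N) + 1"
        using N[of t] infnorm_le_norm_bmfun[of "F N" t] by (simp add: infnorm_sub)
      finally have "sqrt (real DIM('b)) * infnorm (g t) \<le> sqrt (real DIM('b)) * (norm (F N) + 1)"
        by (rule mult_left_mono) simp
      then show ?thesis using norm_le_infnorm[of "g t"] by linarith
    qed
    then show ?thesis by (auto intro: boundedI)
  qed
  with meas have app: "apply_bmfun (Bmfun g) = g" by (simp add: Bmfun_inverse)
  have "F \<longlonglongrightarrow> Bmfun g"
  proof (rule metric_LIMSEQ_I)
    fix e :: real assume "e > 0"
    then obtain N where N: "\<And>n t. n \<ge> N \<Longrightarrow> infnorm (apply_bmfun (F n) t - g t) \<le> e / 2"
      using lim[of "e / 2"] by auto
    have "dist (F n) (Bmfun g) < e" if "n \<ge> N" for n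
    proof -
      have "norm (F n - Bmfun g) \<le> e / 2"
        by (rule norm_bmfun_leI) (use N[OF that] in \<open>simp add: minus_bmfun.rep_eq app\<close>)
      then show ?thesis using \<open>e > 0\<close> by (simp add: dist_norm)
    qed
    then show "\<exists>N. \<forall>n\<ge>N. dist (F n) (Bmfun g) < e" by blast
  qed
  then show "convergent F" by (auto simp: convergent_def)
qed

definition continuous_bmfuns :: "('a::topological_space, 'b::euclidean_space) bmfun set"
  where "continuous_bmfuns = {f. continuous_on UNIV (apply_bmfun f)}"

definition compact_system :: "'g set set \<Rightarrow> bool"
  where "compact_system \<S> \<longleftrightarrow>
    (\<forall>\<C>\<subseteq>\<S>. (\<forall>\<D>\<subseteq>\<C>. finite \<D> \<longrightarrow> \<Inter>\<D> \<noteq> {}) \<longrightarrow> \<Inter>\<C> \<noteq> {})"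

text \<open>The ambient Banach space of the pair is the whole type \<open>'g\<close>.\<close>

definition admissible_pair :: "'g::banach set \<Rightarrow> bool"
  where "admissible_pair F \<longleftrightarrow>
    subspace F \<and> closed F \<and> compact_system {cball x \<rho> | x \<rho>. x \<in> F \<and> 0 < \<rho>}"

text \<open>
  Expectations of nonnegative variables are \<open>ennreal\<close>-valued, so that an infinite moment is
  \<open>\<infinity>\<close>, and not \<open>0\<close> as for the Bochner integral.
\<close>

definition ennreal_root :: "real \<Rightarrow> ennreal \<Rightarrow> ennreal"
  where "ennreal_root r x = (if x = \<infinity> then \<infinity> else ennreal (enn2real x powr (1 / r)))"

definition quantization_error ::
    "'w measure \<Rightarrow> real \<Rightarrow> ('w \<Rightarrow> 'g::banach) \<Rightarrow> 'g set \<Rightarrow> ennreal"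
  where "quantization_error M r X \<alpha> =
    ennreal_root r (\<integral>\<^sup>+\<omega>. ennreal (MIN a\<in>\<alpha>. norm (X \<omega> - a) powr r) \<partial>M)"

text \<open>Infinite sets have \<open>card\<close> zero, so the lower bound on \<open>card\<close> also enforces finiteness.\<close>

definition optimal_quantizers ::
    "'w measure \<Rightarrow> nat \<Rightarrow> real \<Rightarrow> ('w \<Rightarrow> 'g::banach) \<Rightarrow> 'g set set"
  where "optimal_quantizers M n r X =
    {\<alpha>. 1 \<le> card \<alpha> \<and> card \<alpha> \<le> n \<and>
        quantization_error M r X \<alpha> =
          (INF \<beta>\<in>{\<beta>. 1 \<le> card \<beta> \<and> card \<beta> \<le> n}. quantization_error M r X \<beta>)}"

end

theory Submission
  imports Defs "HOL-Library.Diagonal_Subsequence"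
begin

text \<open>
  Admissibility rests on the order of the real line. In the maximum norm, a function belongs to the
  ball about \<open>x\<close> with radius \<open>\<rho>\<close> exactly if each of its coordinates lies between those of \<open>x - \<rho>\<close> and
  \<open>x + \<rho>\<close>. If any two balls of a family meet, then every lower bound lies below every upper bound, and
  the pointwise supremum of the lower bounds is a common point as soon as it is measurable. With
  continuous centres it is lower semicontinuous, hence Borel
  (\<open>compact_system_cballs_continuous_bmfuns\<close>).

  Existence of optimal quantizers holds for every compact ball system and every random variable
  in the closure of a countable set \<open>D\<close> of centres (\<open>optimal_quantizers_nonempty\<close>). Take codebooks of
  at most \<open>n\<close> points whose errors approach the infimum. Their points need not converge, but
  after a diagonal argument their distances to all elements of \<open>D\<close> do, with limits in \<open>[0, \<infinity>]\<close>.
  Compactness of the ball system yields points whose distances to the elements of \<open>D\<close> do not exceed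
  these limits (\<open>compact_system_limit_centre\<close>). Thus the error is lower semicontinuous along the
  sequence, pointwise by \<open>eventually_norm_diff_gt\<close> and in the mean by Fatou's lemma, so the codebook of
  these points is optimal.

  To apply this to a process with continuous paths on a compact metric space, one needs that the
  continuous functions are separable (\<open>countable_dense_continuous_bmfuns\<close>) and that the distance of
  the process from a fixed function is measurable. For continuous functions the latter is seen on a
  countable dense set of times, for general Borel functions it follows by separability
  (\<open>borel_measurable_norm_diff_continuous_process\<close>, \<open>borel_measurable_norm_diff\<close>).
\<close>

section \<open>Balls with continuous centres in the space of bounded Borel functions\<close>

lemma infnorm_leI:
  fixes v :: "'b::euclidean_space"
  assumes "\<And>b. b \<in> Basis \<Longrightarrow> \<bar>v \<bullet> b\<bar> \<le> c"
  shows "infnorm v \<le> c"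
  using assms by (simp add: infnorm_Max)

text \<open>
  A common point of the balls \<open>cball x \<rho>\<close> is a function squeezed, in every coordinate, between all the
  \<open>x - \<rho>\<close> and all the \<open>x + \<rho>\<close>. Two balls that meet satisfy \<open>x - \<rho> \<le> y + \<sigma>\<close>, so the pointwise
  supremum of the lower bounds lies below every upper bound. This supremum may run over uncountably
  many functions; it is Borel nevertheless, because a supremum of continuous functions is lower
  semicontinuous. It need not be continuous, so the common point is sought among the Borel functions.
\<close>

lemma compact_system_cballs_continuous_bmfuns:
  "compact_system {cball x \<rho> | x \<rho>. x \<in> (continuous_bmfuns :: ('a::topological_space, 'b::euclidean_space) bmfun set) \<and> 0 < \<rho>}"
  unfolding compact_system_def
proof (intro allI impI)
  fix \<C> :: "('a, 'b) bmfun set set"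
  assume sub: "\<C> \<subseteq> {cball x \<rho> | x \<rho>. x \<in> continuous_bmfuns \<and> 0 < \<rho>}"
    and fip: "\<forall>\<D>\<subseteq>\<C>. finite \<D> \<longrightarrow> \<Inter>\<D> \<noteq> {}"
  define I where "I = {(x, \<rho>). x \<in> continuous_bmfuns \<and> cball x \<rho> \<in> \<C>}"
  show "\<Inter>\<C> \<noteq> {}"
  proof (cases "I = {}")
    case True
    then have "\<C> = {}" using sub by (force simp: I_def)
    then show ?thesis by simp
  next
    case False
    then obtain x0 \<rho>0 where I0: "(x0, \<rho>0) \<in> I" by auto
    have cross: "apply_bmfun x t \<bullet> b - \<rho> \<le> apply_bmfun y t \<bullet> b + \<sigma>"
      if "(x, \<rho>) \<in> I" "(y, \<sigma>) \<in> I" "b \<in> Basis" for x y \<rho> \<sigma> t b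
    proof -
      have "{cball x \<rho>, cball y \<sigma>} \<subseteq> \<C>" using that by (auto simp: I_def)
      then have "\<Inter>{cball x \<rho>, cball y \<sigma>} \<noteq> {}" using fip by blast
      then obtain z where z: "norm (x - z) \<le> \<rho>" "norm (y - z) \<le> \<sigma>" by (auto simp: dist_norm)
      have "\<bar>(apply_bmfun u t - apply_bmfun z t) \<bullet> b\<bar> \<le> norm (u - z)" for u
        using Basis_le_infnorm[OF that(3), of "apply_bmfun (u - z) t"] infnorm_le_norm_bmfun[of "u - z" t]
        by (simp add: minus_bmfun.rep_eq)
      from this[of x] this[of y] show ?thesis using z by (simp add: inner_diff_left)
    qed
    \<comment> \<open>the coordinates of the common point: the least function above all lower bounds\<close>
    define g where "g b t = (SUP i\<in>I. apply_bmfun (fst i) t \<bullet> b - snd i)" for b t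
    have bdd: "bdd_above ((\<lambda>i. apply_bmfun (fst i) t \<bullet> b - snd i) ` I)" if "b \<in> Basis" for b t
      using cross[OF _ I0 that] by (intro bdd_aboveI2[where M = "apply_bmfun x0 t \<bullet> b + \<rho>0"]) auto
    have g_lower: "apply_bmfun x t \<bullet> b - \<rho> \<le> g b t" if "(x, \<rho>) \<in> I" "b \<in> Basis" for x \<rho> b t
      using cSUP_upper[OF that(1) bdd[OF that(2)]] by (simp add: g_def)
    have g_upper: "g b t \<le> apply_bmfun x t \<bullet> b + \<rho>" if "(x, \<rho>) \<in> I" "b \<in> Basis" for x \<rho> b t
      unfolding g_def using False cross[OF _ that] by (intro cSUP_least) auto
    have g_meas: "g b \<in> borel_measurable borel" if b: "b \<in> Basis" for b
    proof (rule borel_measurableI_greater)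
      fix c
      have "{t \<in> space borel. c < g b t} = (\<Union>i\<in>I. {t. c < apply_bmfun (fst i) t \<bullet> b - snd i})"
        using less_cSUP_iff[OF False bdd[OF b]] by (auto simp: g_def)
      moreover have "open (\<Union>i\<in>I. {t. c < apply_bmfun (fst i) t \<bullet> b - snd i})"
        by (intro open_UN ballI open_Collect_less continuous_intros)
           (auto simp: I_def continuous_bmfuns_def)
      ultimately show "{t \<in> space borel. c < g b t} \<in> sets borel" by simp
    qed
    define f where "f t = (\<Sum>b\<in>Basis. g b t *\<^sub>R b)" for t
    have f_near: "infnorm (apply_bmfun x t - f t) \<le> \<rho>" if "(x, \<rho>) \<in> I" for x \<rho> t
    proof (rule infnorm_leI)
      fix b :: 'b assume b: "b \<in> Basis"
      then have "f t \<bullet> b = g b t" by (simp add: f_def inner_sum_left_Basis)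
      then show "\<bar>(apply_bmfun x t - f t) \<bullet> b\<bar> \<le> \<rho>"
        using g_lower[OF that b, of t] g_upper[OF that b, of t] by (simp add: inner_diff_left abs_le_iff)
    qed
    have "f \<in> borel_measurable borel"
      unfolding f_def using g_meas by (intro borel_measurable_sum borel_measurable_scaleR) auto
    moreover have "bounded (range f)"
    proof -
      have "norm (f t) \<le> sqrt (real DIM('b)) * (norm x0 + \<rho>0)" for t
      proof -
        have "infnorm (f t) \<le> infnorm (apply_bmfun x0 t) + infnorm (f t - apply_bmfun x0 t)"
          using infnorm_triangle[of "apply_bmfun x0 t" "f t - apply_bmfun x0 t"] by simp
        also have "\<dots> \<le> norm x0 + \<rho>0"
          using f_near[OF I0, of t] infnorm_le_norm_bmfun[of x0 t] by (simp add: infnorm_sub)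
        finally have "sqrt (real DIM('b)) * infnorm (f t) \<le> sqrt (real DIM('b)) * (norm x0 + \<rho>0)"
          by (rule mult_left_mono) simp
        then show ?thesis using norm_le_infnorm[of "f t"] by linarith
      qed
      then show ?thesis by (auto intro: boundedI)
    qed
    ultimately have f: "apply_bmfun (Bmfun f) = f" by (simp add: Bmfun_inverse)
    have "Bmfun f \<in> B" if "B \<in> \<C>" for B
    proof -
      have "B \<in> {cball x \<rho> | x \<rho>. x \<in> continuous_bmfuns \<and> 0 < \<rho>}" using that sub by blast
      then obtain x \<rho> where "B = cball x \<rho>" "x \<in> continuous_bmfuns" by blast
      with that have B: "B = cball x \<rho>" "(x, \<rho>) \<in> I" by (auto simp: I_def)
      have "norm (x - Bmfun f) \<le> \<rho>"
        by (rule norm_bmfun_leI) (simp add: minus_bmfun.rep_eq f f_near[OF B(2)])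
      then show ?thesis by (simp add: B(1) dist_norm)
    qed
    then show ?thesis by auto
  qed
qed

text \<open>
  The sup norm of the coordinate maximum and uniform convergence for the Euclidean distance agree up
  to the factor \<open>sqrt DIM('b)\<close>, so this is the uniform limit theorem.
\<close>

lemma closed_continuous_bmfuns:
  "closed (continuous_bmfuns :: ('a::topological_space, 'b::euclidean_space) bmfun set)"
  unfolding closed_sequential_limits
proof (intro allI impI)
  fix h :: "nat \<Rightarrow> ('a, 'b) bmfun" and f
  assume h: "(\<forall>j. h j \<in> continuous_bmfuns) \<and> h \<longlonglongrightarrow> f"
  have "uniform_limit UNIV (\<lambda>j. apply_bmfun (h j)) (apply_bmfun f) sequentially"
  proof (rule uniform_limitI)
    fix e :: real assume "e > 0"
    define K where "K = sqrt (real DIM('b))"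
    have "K > 0" by (simp add: K_def)
    have "eventually (\<lambda>j. dist (h j) f < e / K) sequentially"
      using h \<open>e > 0\<close> \<open>K > 0\<close> by (intro tendstoD) auto
    then show "\<forall>\<^sub>F j in sequentially. \<forall>t\<in>UNIV. dist (apply_bmfun (h j) t) (apply_bmfun f t) < e"
    proof (eventually_elim, intro ballI)
      fix j t
      assume elim: "dist (h j) f < e / K"
      have "dist (apply_bmfun (h j) t) (apply_bmfun f t) \<le> K * infnorm (apply_bmfun (h j - f) t)"
        unfolding dist_norm K_def minus_bmfun.rep_eq by (rule norm_le_infnorm)
      also have "\<dots> \<le> K * dist (h j) f"
        using \<open>K > 0\<close> infnorm_le_norm_bmfun[of "h j - f" t] by (simp add: dist_norm)
      also have "\<dots> < e" using elim \<open>K > 0\<close> by (simp add: field_simps)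
      finally show "dist (apply_bmfun (h j) t) (apply_bmfun f t) < e" .
    qed
  qed
  then show "f \<in> continuous_bmfuns"
    using h by (auto simp: continuous_bmfuns_def intro: uniform_limit_theorem[OF always_eventually])
qed

lemma subspace_continuous_bmfuns: "subspace continuous_bmfuns"
  by (rule subspaceI)
     (auto simp: continuous_bmfuns_def zero_bmfun.rep_eq plus_bmfun.rep_eq scaleR_bmfun.rep_eq
       intro!: continuous_intros)

theorem admissible_pair_continuous_bmfuns:
  "admissible_pair (continuous_bmfuns :: ('a::topological_space, 'b::euclidean_space) bmfun set)"
  by (simp add: admissible_pair_def subspace_continuous_bmfuns closed_continuous_bmfuns
      compact_system_cballs_continuous_bmfuns)

section \<open>Separability and measurability for continuous paths\<close>

lemma compact_finite_nets:
  assumes comp: "compact (UNIV :: 'a::metric_space set)"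
  obtains S :: "nat \<Rightarrow> 'a::metric_space set"
  where "\<And>N. finite (S N)" "\<And>N t. \<exists>s\<in>S N. dist s t < 1 / real (Suc N)"
proof -
  have "\<exists>S :: 'a set. finite S \<and> (\<forall>t. \<exists>s\<in>S. dist s t < 1 / real (Suc N))" for N
  proof -
    have "UNIV \<subseteq> (\<Union>s\<in>UNIV. ball (s :: 'a) (1 / real (Suc N)))"
      using centre_in_ball by fastforce
    then obtain S where "finite S" "UNIV \<subseteq> (\<Union>s\<in>S. ball (s :: 'a) (1 / real (Suc N)))"
      using compactE_image[OF comp] by (metis open_ball)
    then show ?thesis by (auto simp: subset_iff intro!: exI[of _ S])
  qed
  then show thesis using that by metis
qed

text \<open>
  By uniform continuity, a continuous function is determined up to \<open>2 / Suc m\<close> by rounding its values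
  on a sufficiently fine finite net to a countable dense set of vectors. There are only countably many
  pairs of a net and such rounded values, and it is enough to keep one continuous function for each
  pair that some continuous function realises.
\<close>

lemma countable_dense_continuous_bmfuns:
  assumes "compact (UNIV :: 'a::metric_space set)"
  obtains D :: "('a::metric_space, 'b::euclidean_space) bmfun set"
  where "countable D" "D \<subseteq> continuous_bmfuns" "continuous_bmfuns \<subseteq> closure D"
proof -
  obtain S where S: "\<And>N. finite (S N)" "\<And>N (t :: 'a). \<exists>s\<in>S N. dist s t < 1 / real (Suc N)"
    using compact_finite_nets[OF assms] by blast
  obtain Q :: "'b set" where Q: "countable Q" "\<And>X. open X \<Longrightarrow> X \<noteq> {} \<Longrightarrow> \<exists>d\<in>Q. d \<in> X"
    using countable_dense_setE by blast
  \<comment> \<open>\<open>q\<close> records the values on the net \<open>S N\<close>; the tolerance \<open>m\<close> and the mesh \<open>N\<close> are independent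
    because the mesh that a tolerance requires depends on the modulus of continuity\<close>
  define fits :: "(nat \<times> nat) \<times> ('a \<Rightarrow> 'b) \<Rightarrow> ('a, 'b) bmfun \<Rightarrow> bool" where
    "fits = (\<lambda>((m, N), q) f. f \<in> continuous_bmfuns \<and>
       (\<forall>s\<in>S N. \<forall>t. dist s t < 1 / real (Suc N) \<longrightarrow> infnorm (apply_bmfun f t - q s) \<le> 1 / real (Suc m)))"
  define J where "J = (SIGMA p:UNIV. PiE (S (snd p)) (\<lambda>_. Q)) \<inter> {i. \<exists>f. fits i f}"
  define D where "D = (\<lambda>i. SOME f. fits i f) ` J"
  have pick: "fits i (SOME f. fits i f)" if "i \<in> J" for i
    using that unfolding J_def by (auto intro: someI_ex)
  have "countable D"
    unfolding D_def J_def using S Q by (intro countable_image countable_Int1 countable_SIGMA countable_PiE) auto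
  moreover have "D \<subseteq> continuous_bmfuns"
    using pick by (auto simp: D_def fits_def split: prod.splits)
  moreover have "g \<in> closure D" if g: "g \<in> continuous_bmfuns" for g
    unfolding closure_approachable
  proof (intro allI impI)
    fix e :: real assume "e > 0"
    then obtain m where m: "1 / real (Suc m) < e / 2"
      using reals_Archimedean[of "e / 2"] by (auto simp: inverse_eq_divide)
    define \<eta> where "\<eta> = 1 / real (Suc m) / 2"
    have "\<eta> > 0" by (simp add: \<eta>_def)
    have "uniformly_continuous_on UNIV (apply_bmfun g)"
      using g assms by (auto simp: continuous_bmfuns_def intro: compact_uniformly_continuous)
    then obtain \<delta> where \<delta>: "\<delta> > 0"
      "\<And>s t. dist s t < \<delta> \<Longrightarrow> dist (apply_bmfun g s) (apply_bmfun g t) < \<eta>"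
      using \<open>\<eta> > 0\<close> unfolding uniformly_continuous_on_def by (metis UNIV_I dist_commute)
    then obtain N where N: "1 / real (Suc N) < \<delta>"
      using reals_Archimedean[of \<delta>] by (auto simp: inverse_eq_divide)
    have "\<forall>s. \<exists>d\<in>Q. d \<in> ball (apply_bmfun g s) \<eta>"
      using \<open>\<eta> > 0\<close> by (intro allI Q(2)) auto
    then obtain q0 where q0: "\<And>s. q0 s \<in> Q" "\<And>s. dist (apply_bmfun g s) (q0 s) < \<eta>"
      by (metis mem_ball)
    \<comment> \<open>\<open>restrict\<close> makes \<open>q\<close> one of the countably many extensional functions on the net\<close>
    define q where "q = restrict q0 (S N)"
    have "fits ((m, N), q) g"
    proof -
      have "infnorm (apply_bmfun g t - q s) \<le> 1 / real (Suc m)"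
        if "s \<in> S N" "dist s t < 1 / real (Suc N)" for s t
      proof -
        have "dist (apply_bmfun g t) (q0 s) \<le> dist (apply_bmfun g s) (apply_bmfun g t) + dist (apply_bmfun g s) (q0 s)"
          by (rule dist_triangle3)
        also have "\<dots> < \<eta> + \<eta>" using \<delta>(2)[of s t] q0(2)[of s] that N by (intro add_strict_mono) auto
        also have "\<eta> + \<eta> = 1 / real (Suc m)" unfolding \<eta>_def by (rule field_sum_of_halves)
        finally have "norm (apply_bmfun g t - q s) \<le> 1 / real (Suc m)"
          using that by (simp add: q_def dist_norm)
        then show ?thesis using infnorm_le_norm order_trans by blast
      qed
      then show ?thesis using g by (simp add: fits_def)
    qed
    moreover have "((m, N), q) \<in> (SIGMA p:UNIV. PiE (S (snd p)) (\<lambda>_. Q))"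
      using q0(1) by (auto simp: q_def)
    ultimately have inJ: "((m, N), q) \<in> J" unfolding J_def by blast
    define h where "h = (SOME f. fits ((m, N), q) f)"
    have "fits ((m, N), q) h" unfolding h_def by (rule pick[OF inJ])
    have "norm (h - g) \<le> 2 * (1 / real (Suc m))"
    proof (rule norm_bmfun_leI)
      fix t
      obtain s where s: "s \<in> S N" "dist s t < 1 / real (Suc N)" using S(2) by blast
      have "infnorm (apply_bmfun h t - q s) \<le> 1 / real (Suc m)" "infnorm (apply_bmfun g t - q s) \<le> 1 / real (Suc m)"
        using \<open>fits ((m, N), q) h\<close> \<open>fits ((m, N), q) g\<close> s by (auto simp: fits_def)
      then show "infnorm (apply_bmfun (h - g) t) \<le> 2 * (1 / real (Suc m))"
        using infnorm_triangle[of "apply_bmfun h t - q s" "q s - apply_bmfun g t"]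
          infnorm_sub[of "q s" "apply_bmfun g t"]
        by (simp add: minus_bmfun.rep_eq)
    qed
    moreover have "h \<in> D" unfolding D_def h_def using inJ by (rule imageI)
    ultimately show "\<exists>y\<in>D. dist y g < e" using m by (auto simp: dist_norm intro!: bexI[of _ h])
  qed
  ultimately show thesis by (intro that) auto
qed

text \<open>
  Only the coordinate variables \<open>X t\<close> are known to be measurable. For a continuous path and a
  continuous centre the supremum over the domain is the supremum over a countable dense subset, hence
  measurable.
\<close>

lemma borel_measurable_norm_diff_continuous_process:
  fixes X :: "'a::metric_space \<Rightarrow> 'w \<Rightarrow> 'b::euclidean_space"
  assumes comp: "compact (UNIV :: 'a set)"
    and X: "\<And>t. X t \<in> borel_measurable M"
    and cont: "\<And>\<omega>. \<omega> \<in> space M \<Longrightarrow> continuous_on UNIV (\<lambda>t. X t \<omega>)"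
    and x: "x \<in> continuous_bmfuns"
  shows "(\<lambda>\<omega>. norm (Bmfun (\<lambda>t. X t \<omega>) - x)) \<in> borel_measurable M"
proof (rule borel_measurableI_le)
  fix c
  obtain S where S: "\<And>N. finite (S N)" "\<And>N (t :: 'a). \<exists>s\<in>S N. dist s t < 1 / real (Suc N)"
    using compact_finite_nets[OF comp] by blast
  define T0 where "T0 = (\<Union>N. S N)"
  have T0: "countable T0" using S by (auto simp: T0_def countable_finite)
  have dense: "t \<in> closure T0" for t
    unfolding closure_approachable
  proof (intro allI impI)
    fix e :: real assume "e > 0"
    then obtain N where "1 / real (Suc N) < e"
      using reals_Archimedean[of e] by (auto simp: inverse_eq_divide)
    then show "\<exists>y\<in>T0. dist y t < e" using S(2)[of N t] by (force simp: T0_def)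
  qed
  have "norm (Bmfun (\<lambda>t. X t \<omega>) - x) \<le> c \<longleftrightarrow> (\<forall>t\<in>T0. infnorm (X t \<omega> - apply_bmfun x t) \<le> c)"
    if \<omega>: "\<omega> \<in> space M" for \<omega>
  proof -
    have app: "apply_bmfun (Bmfun (\<lambda>t. X t \<omega>) - x) t = X t \<omega> - apply_bmfun x t" for t
      using Bmfun_inverse_continuous[OF comp cont[OF \<omega>]] by (simp add: minus_bmfun.rep_eq)
    have "closed {t. infnorm (X t \<omega> - apply_bmfun x t) \<le> c}"
      using x cont[OF \<omega>] by (intro closed_Collect_le continuous_intros) (auto simp: continuous_bmfuns_def)
    then have "infnorm (X t \<omega> - apply_bmfun x t) \<le> c"
      if "\<forall>t\<in>T0. infnorm (X t \<omega> - apply_bmfun x t) \<le> c" for t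
      using closure_minimal[of T0 "{t. infnorm (X t \<omega> - apply_bmfun x t) \<le> c}"] that dense[of t] by auto
    then show ?thesis
      using norm_bmfun_leI[of "Bmfun (\<lambda>t. X t \<omega>) - x" c] infnorm_le_norm_bmfun[of "Bmfun (\<lambda>t. X t \<omega>) - x"]
      unfolding app by (meson order_trans)
  qed
  then have "{\<omega> \<in> space M. norm (Bmfun (\<lambda>t. X t \<omega>) - x) \<le> c} =
      {\<omega> \<in> space M. \<forall>t\<in>T0. infnorm (X t \<omega> - apply_bmfun x t) \<le> c}" by auto
  also have "\<dots> \<in> sets M"
  proof (rule sets.sets_Collect_countable_All'[OF _ T0])
    fix t
    have "(\<lambda>\<omega>. infnorm (X t \<omega> - apply_bmfun x t)) \<in> borel_measurable M"
      using X by (intro measurable_compose[OF _ borel_measurable_continuous_onI[of infnorm]]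
          borel_measurable_diff continuous_intros) auto
    then show "{\<omega> \<in> space M. infnorm (X t \<omega> - apply_bmfun x t) \<le> c} \<in> sets M" by simp
  qed
  finally show "{\<omega> \<in> space M. norm (Bmfun (\<lambda>t. X t \<omega>) - x) \<le> c} \<in> sets M" .
qed

section \<open>Optimal quantizers from compact ball systems\<close>

text \<open>
  A sequential form of Tychonoff's theorem: every sequence in a complete linear order with its order
  topology has a convergent subsequence, and Cantor's diagonal argument serves countably many
  sequences at once.
\<close>

lemma diagonal_convergent_subsequence:
  fixes f :: "'i \<Rightarrow> nat \<Rightarrow> 'a::{complete_linorder, linorder_topology}"
  assumes "countable I"
  obtains \<sigma> l where "strict_mono (\<sigma> :: nat \<Rightarrow> nat)" "\<And>i. i \<in> I \<Longrightarrow> (\<lambda>j. f i (\<sigma> j)) \<longlonglongrightarrow> l i"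
proof -
  let ?P = "\<lambda>m s. \<exists>l. (\<lambda>j. f (from_nat_into I m) (s j)) \<longlonglongrightarrow> l"
  interpret subseqs ?P
  proof
    fix m and s :: "nat \<Rightarrow> nat"
    show "\<exists>r'. strict_mono r' \<and> ?P m (s \<circ> r')"
      using compact_complete_linorder[of "\<lambda>j. f (from_nat_into I m) (s j)"] by (auto simp: comp_def)
  qed
  have "?P m (diagseq \<circ> (+) (Suc m))" for m
  proof (rule diagseq_holds)
    fix r s :: "nat \<Rightarrow> nat" and m
    assume "strict_mono r" "?P m s"
    then show "?P m (s \<circ> r)"
      using LIMSEQ_subseq_LIMSEQ by (fastforce simp: comp_def)
  qed
  then have "\<exists>l. (\<lambda>j. f (from_nat_into I m) (diagseq j)) \<longlonglongrightarrow> l" for m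
    using LIMSEQ_offset[where k = "Suc m" and f = "\<lambda>j. f (from_nat_into I m) (diagseq j)"]
    by (fastforce simp: comp_def add.commute)
  then have ex: "\<exists>l. (\<lambda>j. f i (diagseq j)) \<longlonglongrightarrow> l" if "i \<in> I" for i
    using from_nat_into_surj[OF assms that] by blast
  show thesis
  proof (rule that[OF subseq_diagseq])
    show "(\<lambda>j. f i (diagseq j)) \<longlonglongrightarrow> (SOME l. (\<lambda>j. f i (diagseq j)) \<longlonglongrightarrow> l)" if "i \<in> I" for i
      by (rule someI_ex[OF ex[OF that]])
  qed
qed

text \<open>
  A bounded sequence in an infinite-dimensional space need not have a convergent subsequence, but its
  distances to the points of \<open>D\<close> may converge. Compactness of the ball system then supplies a point \<open>b\<close>
  that plays the part of a limit: the balls about \<open>x \<in> D\<close> with radius larger than \<open>l x\<close> contain almost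
  all \<open>a j\<close>, so finitely many of them always meet. The limits live in \<open>ennreal\<close> so that a sequence
  escaping to infinity is covered too: \<open>l x = \<infinity>\<close> contributes no ball and puts no constraint on \<open>b\<close>.
\<close>

lemma compact_system_limit_centre:
  fixes a :: "nat \<Rightarrow> 'g::banach"
  assumes comp: "compact_system {cball x \<rho> | x \<rho>. x \<in> F \<and> 0 < \<rho>}"
    and D: "D \<subseteq> F"
    and lim: "\<And>x. x \<in> D \<Longrightarrow> (\<lambda>j. ennreal (norm (x - a j))) \<longlonglongrightarrow> l x"
  shows "\<exists>b. \<forall>x\<in>D. ennreal (norm (x - b)) \<le> l x"
proof -
  \<comment> \<open>balls with radius strictly above \<open>l x\<close>, since the balls of radius \<open>l x\<close> may miss every \<open>a j\<close>\<close>
  define \<C> where "\<C> = {cball x \<rho> | x \<rho>. x \<in> D \<and> 0 < \<rho> \<and> l x < ennreal \<rho>}"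
  have "\<Inter>\<D> \<noteq> {}" if sub: "\<D> \<subseteq> \<C>" and "finite \<D>" for \<D>
  proof -
    have "eventually (\<lambda>j. a j \<in> B) sequentially" if "B \<in> \<D>" for B
    proof -
      from that sub obtain x \<rho> where B: "B = cball x \<rho>" "x \<in> D" "0 < \<rho>" "l x < ennreal \<rho>"
        unfolding \<C>_def by blast
      show ?thesis
        using order_tendstoD(2)[OF lim[OF B(2)] B(4)]
        by eventually_elim (use B in \<open>simp add: ennreal_less_iff dist_norm\<close>)
    qed
    then have "eventually (\<lambda>j. \<forall>B\<in>\<D>. a j \<in> B) sequentially"
      using \<open>finite \<D>\<close> by (simp add: eventually_ball_finite_distrib)
    then obtain j where "\<forall>B\<in>\<D>. a j \<in> B"
      using eventually_happens trivial_limit_sequentially by blast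
    then show ?thesis by auto
  qed
  moreover have "\<C> \<subseteq> {cball x \<rho> | x \<rho>. x \<in> F \<and> 0 < \<rho>}" using D by (auto simp: \<C>_def)
  ultimately have "\<Inter>\<C> \<noteq> {}" using comp unfolding compact_system_def by blast
  then obtain b where b: "\<And>B. B \<in> \<C> \<Longrightarrow> b \<in> B" by auto
  have "ennreal (norm (x - b)) \<le> l x" if "x \<in> D" for x
  proof (rule ccontr)
    assume "\<not> ?thesis"
    then have "l x < ennreal (norm (x - b))" by simp
    then obtain y where y: "l x < y" "y < ennreal (norm (x - b))" using dense by blast
    then obtain \<rho> where \<rho>: "y = ennreal \<rho>" "0 \<le> \<rho>" by (cases y) auto
    have "0 < \<rho>" using y \<rho> by (cases "\<rho> = 0") auto
    then have "b \<in> cball x \<rho>" using y \<rho> that by (intro b) (auto simp: \<C>_def)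
    moreover have "\<rho> < norm (x - b)" using y \<rho> by (simp add: ennreal_less_iff)
    ultimately show False by (simp add: dist_norm)
  qed
  then show ?thesis by blast
qed

text \<open>
  The point \<open>b\<close> of the preceding lemma is asymptotically at least as close as the \<open>a j\<close>, not only to the
  points of \<open>D\<close> but to all points of its closure. This is the lower semicontinuity
  \<open>norm (y - b) \<le> liminf (\<lambda>j. norm (y - a j))\<close>, in the form in which it passes to powers and finite
  minima.
\<close>

lemma eventually_norm_diff_gt:
  fixes a :: "nat \<Rightarrow> 'g::real_normed_vector"
  assumes lim: "\<And>x. x \<in> D \<Longrightarrow> (\<lambda>j. ennreal (norm (x - a j))) \<longlonglongrightarrow> l x"
    and b: "\<And>x. x \<in> D \<Longrightarrow> ennreal (norm (x - b)) \<le> l x"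
    and y: "y \<in> closure D" and c: "c < norm (y - b)"
  shows "eventually (\<lambda>j. c < norm (y - a j)) sequentially"
proof (cases "0 \<le> c")
  case False
  then show ?thesis by (simp add: always_eventually order_less_le_trans[OF _ norm_ge_zero])
next
  case True
  define \<epsilon> where "\<epsilon> = (norm (y - b) - c) / 2"
  have "\<epsilon> > 0" using c by (simp add: \<epsilon>_def)
  then obtain x where x: "x \<in> D" "dist x y < \<epsilon>" using y by (auto simp: closure_approachable)
  have "c + \<epsilon> < norm (x - b)"
    using norm_triangle_ineq[of "y - x" "x - b"] x(2) norm_minus_commute[of x y]
    by (simp add: \<epsilon>_def dist_norm field_simps)
  then have "ennreal (c + \<epsilon>) < ennreal (norm (x - b))"
    using True \<open>\<epsilon> > 0\<close> by (simp add: ennreal_less_iff del: ennreal_plus)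
  then have "ennreal (c + \<epsilon>) < l x" using b[OF x(1)] by (rule less_le_trans)
  from order_tendstoD(1)[OF lim[OF x(1)] this] show ?thesis
  proof eventually_elim
    case (elim j)
    then have "c + \<epsilon> < norm (x - a j)"
      using True \<open>\<epsilon> > 0\<close> by (simp add: ennreal_less_iff del: ennreal_plus)
    then show ?case
      using norm_triangle_ineq[of "x - y" "y - a j"] x(2) by (simp add: dist_norm)
  qed
qed

text \<open>
  Measurability of the distance to the points of \<open>D\<close> carries over to an arbitrary centre \<open>a\<close>, because
  \<open>norm (y - a)\<close> is the infimum of \<open>norm (y - x) + norm (x - a)\<close> over \<open>x \<in> D\<close> when \<open>y \<in> closure D\<close>. In this
  way the centre may be a discontinuous function although the process has continuous paths.
\<close>

lemma borel_measurable_norm_diff: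
  fixes X :: "'w \<Rightarrow> 'g::real_normed_vector"
  assumes D: "countable D"
    and meas: "\<And>x. x \<in> D \<Longrightarrow> (\<lambda>\<omega>. norm (X \<omega> - x)) \<in> borel_measurable M"
    and X: "\<And>\<omega>. \<omega> \<in> space M \<Longrightarrow> X \<omega> \<in> closure D"
  shows "(\<lambda>\<omega>. norm (X \<omega> - a)) \<in> borel_measurable M"
proof (rule borel_measurableI_less)
  fix c
  have "{\<omega> \<in> space M. norm (X \<omega> - a) < c} = (\<Union>x\<in>D. {\<omega> \<in> space M. norm (X \<omega> - x) + norm (x - a) < c})"
  proof (intro equalityI subsetI)
    fix \<omega> assume "\<omega> \<in> {\<omega> \<in> space M. norm (X \<omega> - a) < c}"
    then have \<omega>: "\<omega> \<in> space M" "norm (X \<omega> - a) < c" by auto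
    define \<epsilon> where "\<epsilon> = (c - norm (X \<omega> - a)) / 2"
    have "\<epsilon> > 0" using \<omega> by (simp add: \<epsilon>_def)
    then obtain x where x: "x \<in> D" "dist x (X \<omega>) < \<epsilon>"
      using X[OF \<omega>(1)] by (auto simp: closure_approachable)
    then have "norm (X \<omega> - x) + norm (x - a) < c"
      using norm_triangle_ineq[of "x - X \<omega>" "X \<omega> - a"]
      by (simp add: \<epsilon>_def dist_norm norm_minus_commute)
    then show "\<omega> \<in> (\<Union>x\<in>D. {\<omega> \<in> space M. norm (X \<omega> - x) + norm (x - a) < c})"
      using x \<omega> by auto
  next
    fix \<omega> assume "\<omega> \<in> (\<Union>x\<in>D. {\<omega> \<in> space M. norm (X \<omega> - x) + norm (x - a) < c})"
    then obtain x where "x \<in> D" "\<omega> \<in> space M" "norm (X \<omega> - x) + norm (x - a) < c" by auto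
    then show "\<omega> \<in> {\<omega> \<in> space M. norm (X \<omega> - a) < c}"
      using norm_triangle_ineq[of "X \<omega> - x" "x - a"] by simp
  qed
  also have "\<dots> \<in> sets M"
    using D meas by (intro sets.countable_UN') (auto intro!: borel_measurable_less borel_measurable_add)
  finally show "{\<omega> \<in> space M. norm (X \<omega> - a) < c} \<in> sets M" .
qed

lemma borel_measurable_finite_MIN:
  fixes g :: "'g \<Rightarrow> 'w \<Rightarrow> real"
  assumes "finite \<alpha>" "\<alpha> \<noteq> {}" "\<And>a. a \<in> \<alpha> \<Longrightarrow> g a \<in> borel_measurable M"
  shows "(\<lambda>\<omega>. MIN a\<in>\<alpha>. g a \<omega>) \<in> borel_measurable M"
proof (rule borel_measurableI_greater)
  fix c
  have "{\<omega> \<in> space M. c < (MIN a\<in>\<alpha>. g a \<omega>)} = {\<omega> \<in> space M. \<forall>a\<in>\<alpha>. c < g a \<omega>}"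
    using assms by auto
  also have "\<dots> \<in> sets M"
    using assms by (intro sets.sets_Collect_finite_All') (auto intro: borel_measurable_less)
  finally show "{\<omega> \<in> space M. c < (MIN a\<in>\<alpha>. g a \<omega>)} \<in> sets M" .
qed

lemma mono_ennreal_root:
  assumes "0 < r" "x \<le> y"
  shows "ennreal_root r x \<le> ennreal_root r y"
proof (cases "y = \<infinity>")
  case False
  then have "y < \<infinity>" "x \<noteq> \<infinity>" using assms(2) by (auto simp: less_top top_unique)
  moreover have "enn2real x powr (1 / r) \<le> enn2real y powr (1 / r)"
    using assms \<open>y < \<infinity>\<close> by (intro powr_mono2 enn2real_mono) auto
  ultimately show ?thesis using False by (simp add: ennreal_root_def ennreal_leI)
qed (simp add: ennreal_root_def)

text \<open>
  Since \<open>ennreal_root\<close> is monotone, minimality can be tested on the moments without the root.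
\<close>

lemma optimal_quantizersI:
  fixes X :: "'w \<Rightarrow> 'g::banach"
  assumes r: "0 < r" and card: "1 \<le> card \<alpha>" "card \<alpha> \<le> n"
    and opt: "\<And>\<beta>. 1 \<le> card \<beta> \<Longrightarrow> card \<beta> \<le> n \<Longrightarrow>
      (\<integral>\<^sup>+\<omega>. ennreal (MIN a\<in>\<alpha>. norm (X \<omega> - a) powr r) \<partial>M)
        \<le> (\<integral>\<^sup>+\<omega>. ennreal (MIN a\<in>\<beta>. norm (X \<omega> - a) powr r) \<partial>M)"
  shows "\<alpha> \<in> optimal_quantizers M n r X"
proof -
  let ?S = "{\<beta> :: 'g set. 1 \<le> card \<beta> \<and> card \<beta> \<le> n}"
  have "quantization_error M r X \<alpha> = (INF \<beta>\<in>?S. quantization_error M r X \<beta>)"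
  proof (rule antisym)
    show "quantization_error M r X \<alpha> \<le> (INF \<beta>\<in>?S. quantization_error M r X \<beta>)"
      unfolding quantization_error_def by (intro INF_greatest mono_ennreal_root r opt) auto
    show "(INF \<beta>\<in>?S. quantization_error M r X \<beta>) \<le> quantization_error M r X \<alpha>"
      using card by (intro INF_lower) auto
  qed
  with card show ?thesis unfolding optimal_quantizers_def by blast
qed

text \<open>
  Repeating points gives codebooks of every size up to \<open>n\<close> the same index set, so that a sequence of
  codebooks splits into \<open>n\<close> sequences of points.
\<close>

lemma codebook_enumeration:
  assumes "1 \<le> card \<beta>" "card \<beta> \<le> n"
  obtains a where "\<beta> = a ` {..<n::nat}"
proof -
  have "finite \<beta>" "\<beta> \<noteq> {}" using assms by (auto intro: card_ge_0_finite)
  then obtain h where h: "bij_betw h {..<card \<beta>} \<beta>"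
    using ex_bij_betw_nat_finite[of \<beta>] by (auto simp: atLeast0LessThan)
  let ?a = "\<lambda>k. if k < card \<beta> then h k else h 0"
  have "\<beta> = ?a ` {..<n}"
  proof (intro equalityI subsetI)
    fix y assume "y \<in> \<beta>"
    then obtain k where "k < card \<beta>" "y = h k" using h by (auto simp: bij_betw_def)
    then show "y \<in> ?a ` {..<n}" using assms by (intro image_eqI[of _ _ k]) auto
  next
    fix y assume "y \<in> ?a ` {..<n}"
    then show "y \<in> \<beta>" using assms bij_betwE[OF h] by auto
  qed
  then show thesis by (rule that)
qed

text \<open>
  The direct method of the calculus of variations. Along a minimizing sequence of codebooks, pass to a
  subsequence for which the distances from every \<open>x \<in> D\<close> to the \<open>k\<close>-th point converge for all \<open>k < n\<close>, and
  let \<open>b k\<close> be the limit centres given by the compact ball system. The pointwise error of the codebook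
  of the \<open>b k\<close> is at most the limit inferior of the errors along the subsequence, and Fatou's lemma
  turns this into minimality.
\<close>

theorem optimal_quantizers_nonempty:
  fixes X :: "'w \<Rightarrow> 'g::banach"
  assumes comp: "compact_system {cball x \<rho> | x \<rho>. x \<in> F \<and> 0 < \<rho>}"
    and D: "D \<subseteq> F" "countable D"
    and X: "\<And>\<omega>. \<omega> \<in> space M \<Longrightarrow> X \<omega> \<in> closure D"
    and meas: "\<And>x. x \<in> D \<Longrightarrow> (\<lambda>\<omega>. norm (X \<omega> - x)) \<in> borel_measurable M"
    and r: "0 < r" and n: "1 \<le> n"
  shows "optimal_quantizers M n r X \<noteq> {}"
proof -
  define \<phi> where "\<phi> \<alpha> \<omega> = ennreal (MIN a\<in>\<alpha>. norm (X \<omega> - a) powr r)" for \<alpha> \<omega>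
  define I where "I \<alpha> = (\<integral>\<^sup>+\<omega>. \<phi> \<alpha> \<omega> \<partial>M)" for \<alpha>
  define S where "S = {\<beta> :: 'g set. 1 \<le> card \<beta> \<and> card \<beta> \<le> n}"
  have "{0} \<in> S" using n by (simp add: S_def)
  then obtain u where u: "\<And>j. u j \<in> I ` S" "u \<longlonglongrightarrow> (INF \<beta>\<in>S. I \<beta>)"
    using Inf_as_limit[of "I ` S"] by auto
  have "\<forall>j. \<exists>a. a ` {..<n} \<in> S \<and> I (a ` {..<n}) = u j"
  proof
    fix j
    obtain \<beta> where \<beta>: "\<beta> \<in> S" "I \<beta> = u j" using u(1)[of j] by auto
    then obtain a where "\<beta> = a ` {..<n}" using codebook_enumeration[of \<beta> n] by (auto simp: S_def)
    with \<beta> show "\<exists>a. a ` {..<n} \<in> S \<and> I (a ` {..<n}) = u j" by blast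
  qed
  then obtain a where a: "\<And>j. I (a j ` {..<n}) = u j" by metis
  obtain \<sigma> l where \<sigma>: "strict_mono \<sigma>"
    and l: "\<And>p. p \<in> D \<times> {..<n} \<Longrightarrow> (\<lambda>j. ennreal (norm (fst p - a (\<sigma> j) (snd p)))) \<longlonglongrightarrow> l p"
    using diagonal_convergent_subsequence[of "D \<times> {..<n}" "\<lambda>p j. ennreal (norm (fst p - a j (snd p)))"]
      D(2) by (auto intro: countable_SIGMA)
  have l': "(\<lambda>j. ennreal (norm (x - a (\<sigma> j) k))) \<longlonglongrightarrow> l (x, k)" if "x \<in> D" "k < n" for x k
    using l[of "(x, k)"] that by simp
  have "\<exists>b. \<forall>x\<in>D. ennreal (norm (x - b)) \<le> l (x, k)" if "k < n" for k
    using compact_system_limit_centre[OF comp D(1), of "\<lambda>j. a (\<sigma> j) k" "\<lambda>x. l (x, k)"] l' that by blast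
  then obtain b where b: "\<And>k x. k < n \<Longrightarrow> x \<in> D \<Longrightarrow> ennreal (norm (x - b k)) \<le> l (x, k)" by metis
  define \<alpha> where "\<alpha> = b ` {..<n}"
  have ne: "c ` {..<n} \<noteq> {}" for c :: "nat \<Rightarrow> 'g" using n by (simp add: lessThan_empty_iff)
  have pointwise: "\<phi> \<alpha> \<omega> \<le> liminf (\<lambda>j. \<phi> (a (\<sigma> j) ` {..<n}) \<omega>)" if \<omega>: "\<omega> \<in> space M" for \<omega>
    unfolding le_Liminf_iff
  proof (intro allI impI)
    fix y assume "y < \<phi> \<alpha> \<omega>"
    then obtain q where q: "y = ennreal q" "0 \<le> q" by (cases y) (auto simp: \<phi>_def)
    with \<open>y < \<phi> \<alpha> \<omega>\<close> have "q < (MIN a\<in>\<alpha>. norm (X \<omega> - a) powr r)"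
      by (simp add: \<phi>_def ennreal_less_iff)
    then have qk: "q < norm (X \<omega> - b k) powr r" if "k < n" for k
      using that ne by (auto simp: \<alpha>_def)
    have "eventually (\<lambda>j. q < norm (X \<omega> - a (\<sigma> j) k) powr r) sequentially" if k: "k < n" for k
    proof -
      \<comment> \<open>the comparison of centres concerns norms, so the power is undone and then restored\<close>
      have "q powr (1 / r) < (norm (X \<omega> - b k) powr r) powr (1 / r)"
        using qk[OF k] q r by (intro powr_less_mono2) auto
      also have "\<dots> = norm (X \<omega> - b k)" using r by (simp add: powr_powr)
      finally have "eventually (\<lambda>j. q powr (1 / r) < norm (X \<omega> - a (\<sigma> j) k)) sequentially"
        using eventually_norm_diff_gt[of D "\<lambda>j. a (\<sigma> j) k" "\<lambda>x. l (x, k)" "b k"] l' b k X[OF \<omega>] by blast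
      then show ?thesis
      proof eventually_elim
        case (elim j)
        then have "(q powr (1 / r)) powr r < norm (X \<omega> - a (\<sigma> j) k) powr r"
          using r by (intro powr_less_mono2) auto
        then show ?case using r q by (simp add: powr_powr)
      qed
    qed
    then have "eventually (\<lambda>j. \<forall>k\<in>{..<n}. q < norm (X \<omega> - a (\<sigma> j) k) powr r) sequentially"
      by (simp add: eventually_ball_finite_distrib)
    then show "eventually (\<lambda>j. y < \<phi> (a (\<sigma> j) ` {..<n}) \<omega>) sequentially"
      by eventually_elim (use q ne in \<open>simp add: \<phi>_def ennreal_less_iff\<close>)
  qed
  have \<phi>_meas: "\<phi> (c ` {..<n}) \<in> borel_measurable M" for c
    unfolding \<phi>_def using ne
    by (intro measurable_compose[OF _ measurable_ennreal] borel_measurable_finite_MIN)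
       (auto intro!: powr_real_measurable borel_measurable_norm_diff[OF D(2) meas X])
  have "I \<alpha> \<le> (\<integral>\<^sup>+\<omega>. liminf (\<lambda>j. \<phi> (a (\<sigma> j) ` {..<n}) \<omega>) \<partial>M)"
    unfolding I_def by (intro nn_integral_mono pointwise)
  also have "\<dots> \<le> liminf (\<lambda>j. I (a (\<sigma> j) ` {..<n}))"
    unfolding I_def by (intro nn_integral_liminf \<phi>_meas)
  also have "\<dots> = (INF \<beta>\<in>S. I \<beta>)"
    using LIMSEQ_subseq_LIMSEQ[OF u(2) \<sigma>] by (intro lim_imp_Liminf) (auto simp: a comp_def)
  finally have opt: "I \<alpha> \<le> I \<beta>" if "\<beta> \<in> S" for \<beta>
    using that by (meson INF_lower order_trans)
  have "card \<alpha> \<le> n" using card_image_le[of "{..<n}" b] by (simp add: \<alpha>_def)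
  moreover have "1 \<le> card \<alpha>" using ne by (simp add: \<alpha>_def Suc_le_eq card_gt_0_iff)
  ultimately have "\<alpha> \<in> optimal_quantizers M n r X"
    using opt r by (intro optimal_quantizersI) (auto simp: I_def \<phi>_def S_def)
  then show ?thesis by blast
qed

section \<open>Optimal quantizers for continuous processes\<close>

theorem theorem3:
  assumes "compact (UNIV :: 'a::metric_space set)"
  shows "admissible_pair (continuous_bmfuns :: ('a, real ^ 'd) bmfun set) \<and>
    (\<forall>(M :: 'w measure) (X :: 'a \<Rightarrow> 'w \<Rightarrow> real ^ 'd) (r :: real) (n :: nat).
       prob_space M \<longrightarrow>
       (\<forall>t. X t \<in> borel_measurable M) \<longrightarrow>
       (\<forall>\<omega>\<in>space M. continuous_on UNIV (\<lambda>t. X t \<omega>)) \<longrightarrow>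
       0 < r \<longrightarrow>
       (\<integral>\<^sup>+\<omega>. ennreal (norm (Bmfun (\<lambda>t. X t \<omega>)) powr r) \<partial>M) < \<infinity> \<longrightarrow>
       1 \<le> n \<longrightarrow>
       optimal_quantizers M n r (\<lambda>\<omega>. Bmfun (\<lambda>t. X t \<omega>)) \<noteq> {})"
proof (intro conjI allI impI)
  show "admissible_pair (continuous_bmfuns :: ('a, real ^ 'd) bmfun set)"
    by (rule admissible_pair_continuous_bmfuns)
next
  fix M :: "'w measure" and X :: "'a \<Rightarrow> 'w \<Rightarrow> real ^ 'd" and r :: real and n :: nat
  assume X: "\<forall>t. X t \<in> borel_measurable M"
    and cont: "\<forall>\<omega>\<in>space M. continuous_on UNIV (\<lambda>t. X t \<omega>)"
    and r: "0 < r" and n: "1 \<le> n"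
  obtain D :: "('a, real ^ 'd) bmfun set"
    where D: "countable D" "D \<subseteq> continuous_bmfuns" "continuous_bmfuns \<subseteq> closure D"
    using countable_dense_continuous_bmfuns[OF assms] by blast
  have paths: "Bmfun (\<lambda>t. X t \<omega>) \<in> continuous_bmfuns" if "\<omega> \<in> space M" for \<omega>
    using that cont Bmfun_inverse_continuous[OF assms, of "\<lambda>t. X t \<omega>"]
    by (simp add: continuous_bmfuns_def)
  show "optimal_quantizers M n r (\<lambda>\<omega>. Bmfun (\<lambda>t. X t \<omega>)) \<noteq> {}"
  proof (rule optimal_quantizers_nonempty[OF compact_system_cballs_continuous_bmfuns D(2,1) _ _ r n])
    show "Bmfun (\<lambda>t. X t \<omega>) \<in> closure D" if "\<omega> \<in> space M" for \<omega>
      using paths[OF that] D(3) by blast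
    show "(\<lambda>\<omega>. norm (Bmfun (\<lambda>t. X t \<omega>) - x)) \<in> borel_measurable M" if "x \<in> D" for x
      using borel_measurable_norm_diff_continuous_process[OF assms, of X M x] X cont that D(2) by blast
  qed
qed

end
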